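(* Let $D$ be a reduced knot diagram. There is a bijection between the union of all elements in the image of the KPW correspondence, over all pairs $(v_b,v_w)\in V(G_b)\times V(G_w)$, and the set of perfect discrete Morse functions on $\Xi(D)$.
   Context: Setting. $D$ is (the projection of) a knot diagram with at least one crossing, viewed as a connected 4-valent graph on $S^2$, with a chequerboard black/white colouring of the regions. $D$ is reduced if it has no nugatory crossing, i.e. no crossing has the same region at two of its four corners. The black graph $G_b$ has the black regions as vertices and one edge for each crossing, joining the two black regions opposite each other at that crossing; the white graph $G_w$ is defined analogously and is the plane dual of $G_b$. The overlaid Tait graph $\Gamma(D)$ is the superimposition of $G_b$ and $G_w$ on $S^2$: its vertices are the black regions, the white regions and the crossings, and its edges are the half-edges of $G_b$ and $G_w$, each joining a region to an incident crossing. $\Gamma(D,v_b,v_w)$ is $\Gamma(D)$ with the vertices $v_b\in V(G_b)$, $v_w\in V(G_w)$ removed. KPW (Kenyon–Propp–Wilson) correspondence. For fixed $(v_b,v_w)$ it is the map from the set $Tree(G_b)$ of spanning trees of $G_b$ to perfect matchings on $\Gamma(D,v_b,v_w)$ defined as follows: given $T\in Tree(G_b)$ with dual spanning tree $T^*\subset G_w$ (consisting of the duals of the edges not in $T$), root $T$ at $v_b$ and $T^*$ at $v_w$, orient all edges away from the roots, and match each crossing with the target vertex of the unique oriented edge of $T\cup T^*$ on which it lies. $\Xi(D)$ is the cell structure on $S^2$ with 2-cells the white regions, 1-cells the crossings, 0-cells the black regions. Its poset graph is $\Gamma(D)$, with edges oriented from white vertices to crossings and from crossings to black vertices. A discrete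 Morse function on $\Xi(D)$ means an equivalence class of such functions, i.e. a matching on $\Gamma(D)$ that is acyclic: reversing the orientation of all matched edges yields a directed graph without directed cycles. It is perfect if exactly one 0-cell and one 2-cell are unmatched (critical). *)

theory Defs
  imports "Graph_Theory.Graph_Theory" "HOL-Combinatorics.Orbits"
begin

section \<open>Knot projections as combinatorial maps\<close>

text \<open>
  A connected graph cellularly embedded in the sphere is encoded by its rotation system.  A dart is
  an edge of the diagram together with a choice of one of its two ends, thought of as leaving the
  crossing at that end; \<open>rot\<close> turns a dart counterclockwise to the next dart at the same crossing and
  \<open>opp\<close> exchanges the two darts of an edge.  The field \<open>black\<close> is the set of black regions.

  A dart \<open>d\<close> also stands for the corner between \<open>d\<close> and \<open>rot d\<close> at its crossing, so that darts and
  corners are in bijection.  The corner \<open>d\<close> lies to the left of the dart \<open>d\<close>.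
\<close>

record 'd knot_projection =
  darts :: "'d set"
  rot :: "'d \<Rightarrow> 'd"
  opp :: "'d \<Rightarrow> 'd"
  black :: "'d set set"

definition crossing :: "'d knot_projection \<Rightarrow> 'd \<Rightarrow> 'd set" where
  "crossing D d = orbit (rot D) d"

definition crossings :: "'d knot_projection \<Rightarrow> 'd set set" where
  "crossings D = crossing D ` darts D"

definition edges :: "'d knot_projection \<Rightarrow> 'd set set" where
  "edges D = (\<lambda>d. {d, opp D d}) ` darts D"

text \<open>
  The region containing the corner \<open>d\<close>, as a set of corners: following the edge of \<open>rot d\<close> with the
  region on the right, the next corner of the region is \<open>opp (rot d)\<close>.
\<close>

definition region :: "'d knot_projection \<Rightarrow> 'd \<Rightarrow> 'd set" where
  "region D d = orbit (opp D \<circ> rot D) d"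

definition regions :: "'d knot_projection \<Rightarrow> 'd set set" where
  "regions D = region D ` darts D"

definition white :: "'d knot_projection \<Rightarrow> 'd set set" where
  "white D = regions D - black D"

text \<open>
  The last three conditions say: the curve running straight through every crossing traverses the
  whole diagram, i.e. the projected link has one component (in particular the graph is connected);
  the surface carrying the connected map is the sphere (Euler's formula); and the colouring is
  chequerboard, \<open>region d\<close> and \<open>region (opp d)\<close> being the regions on the two sides of the edge of \<open>d\<close>.
\<close>

definition knot_diagram :: "'d knot_projection \<Rightarrow> bool" where
  "knot_diagram D \<longleftrightarrow>
     finite (darts D) \<and> darts D \<noteq> {} \<and>
     rot D permutes darts D \<and> (\<forall>d\<in>darts D. card (crossing D d) = 4) \<and>
     opp D permutes darts D \<and> (\<forall>d\<in>darts D. opp D d \<noteq> d \<and> opp D (opp D d) = d) \<and>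
     (\<forall>d\<in>darts D. let C = orbit (rot D \<circ> rot D \<circ> opp D) d in C \<union> opp D ` C = darts D) \<and>
     card (crossings D) + card (regions D) = card (edges D) + 2 \<and>
     black D \<subseteq> regions D \<and> (\<forall>d\<in>darts D. region D d \<in> black D \<longleftrightarrow> region D (opp D d) \<notin> black D)"

definition reduced :: "'d knot_projection \<Rightarrow> bool" where
  "reduced D \<longleftrightarrow> (\<forall>c\<in>crossings D. inj_on (region D) c)"


section \<open>Tait graphs and the Kenyon-Propp-Wilson correspondence\<close>

text \<open>
  The spanning subgraph of the Tait graph on the regions \<open>R\<close> (\<open>black D\<close> or \<open>white D\<close>) whose set of
  edges is the set \<open>X\<close> of crossings.  An undirected multigraph is represented by a digraph with two
  arcs for every edge, one for each of its orientations: the arc \<open>d\<close> goes from the region at the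
  corner \<open>d\<close> to the region at the opposite corner \<open>rot (rot d)\<close> of the same crossing.
\<close>

definition tait_graph :: "'d knot_projection \<Rightarrow> 'd set set \<Rightarrow> 'd set set \<Rightarrow> ('d set, 'd) pre_digraph" where
  "tait_graph D R X =
     \<lparr> verts = R,
       arcs = {d \<in> darts D. region D d \<in> R \<and> crossing D d \<in> X},
       tail = region D,
       head = (\<lambda>d. region D (rot D (rot D d))) \<rparr>"

text \<open>
  The library's \<open>tree\<close> excludes directed cycles, hence all pairs of opposite arcs, and does not fit
  this representation.  A cycle of the undirected multigraph is a directed cycle that does not
  use an edge twice.
\<close>

definition spanning_trees :: "'d knot_projection \<Rightarrow> 'd set set \<Rightarrow> 'd set set set" where
  "spanning_trees D R =
     {T. T \<subseteq> crossings D \<and> connected (tait_graph D R T) \<and>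
         \<not> (\<exists>p. pre_digraph.cycle (tait_graph D R T) p \<and> distinct (map (crossing D) p))}"

text \<open>
  The arcs directed away from the root \<open>r\<close>, for a digraph representing an undirected tree: those
  with which some simple path starting at \<open>r\<close> ends.
\<close>

definition away_from :: "('v, 'a) pre_digraph \<Rightarrow> 'v \<Rightarrow> 'a set" where
  "away_from G r = {a. \<exists>p v. pre_digraph.apath G r (p @ [a]) v}"

text \<open>
  A matching is a set of edges of the overlaid Tait graph, i.e. a set of corners: the corner \<open>d\<close> is
  the half-edge that joins \<open>crossing d\<close> to \<open>region d\<close>.  The half-edge at the target of the arc \<open>d\<close> of
  a Tait graph is the corner \<open>rot (rot d)\<close>.  The dual of an edge lies on the same crossing, so the
  dual tree of \<open>T\<close> is \<open>crossings D - T\<close>.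
\<close>

definition kpw :: "'d knot_projection \<Rightarrow> 'd set \<Rightarrow> 'd set \<Rightarrow> 'd set set \<Rightarrow> 'd set" where
  "kpw D v\<^sub>b v\<^sub>w T =
     (\<lambda>d. rot D (rot D d)) `
       (away_from (tait_graph D (black D) T) v\<^sub>b \<union>
        away_from (tait_graph D (white D) (crossings D - T)) v\<^sub>w)"


section \<open>Discrete Morse functions\<close>

text \<open>
  The cells of the cell structure are the regions (black: dimension 0, white: dimension 2) and the
  crossings (dimension 1).  Its poset graph is the overlaid Tait graph, oriented from white
  regions to crossings and from crossings to black regions.
\<close>

datatype 'd cell = Region "'d set" | Crossing "'d set"

definition poset_graph :: "'d knot_projection \<Rightarrow> ('d cell, 'd) pre_digraph" where
  "poset_graph D =
     \<lparr> verts = Region ` regions D \<union> Crossing ` crossings D,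
       arcs = darts D,
       tail = (\<lambda>d. if region D d \<in> black D then Crossing (crossing D d) else Region (region D d)),
       head = (\<lambda>d. if region D d \<in> black D then Region (region D d) else Crossing (crossing D d)) \<rparr>"

definition ends :: "('v, 'a) pre_digraph \<Rightarrow> 'a \<Rightarrow> 'v set" where
  "ends G a = {tail G a, head G a}"

definition is_matching :: "('v, 'a) pre_digraph \<Rightarrow> 'a set \<Rightarrow> bool" where
  "is_matching G M \<longleftrightarrow> M \<subseteq> arcs G \<and> (\<forall>a\<in>M. \<forall>b\<in>M. a \<noteq> b \<longrightarrow> ends G a \<inter> ends G b = {})"

definition reverse_arcs :: "('v, 'a) pre_digraph \<Rightarrow> 'a set \<Rightarrow> ('v, 'a) pre_digraph" where
  "reverse_arcs G M =
     \<lparr> verts = verts G,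
       arcs = arcs G,
       tail = (\<lambda>a. if a \<in> M then head G a else tail G a),
       head = (\<lambda>a. if a \<in> M then tail G a else head G a) \<rparr>"

definition acyclic_matching :: "('v, 'a) pre_digraph \<Rightarrow> 'a set \<Rightarrow> bool" where
  "acyclic_matching G M \<longleftrightarrow>
     is_matching G M \<and> \<not> (\<exists>p. pre_digraph.cycle (reverse_arcs G M) p)"

definition unmatched :: "('v, 'a) pre_digraph \<Rightarrow> 'a set \<Rightarrow> 'v set" where
  "unmatched G M = verts G - (\<Union>a\<in>M. ends G a)"

definition discrete_morse_functions :: "'d knot_projection \<Rightarrow> 'd set set" where
  "discrete_morse_functions D = {M. acyclic_matching (poset_graph D) M}"

definition perfect_discrete_morse_functions :: "'d knot_projection \<Rightarrow> 'd set set" where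
  "perfect_discrete_morse_functions D =
     {M \<in> discrete_morse_functions D.
        \<exists>b\<in>black D. \<exists>w\<in>white D. unmatched (poset_graph D) M = {Region b, Region w}}"

end

(* The two sets coincide.  In the reversed poset graph the black regions can be left only through
   matched edges and no directed path leads from a black region to a white one, so every directed
   cycle stays on one colour, and a matching is acyclic and perfect iff its black and white halves
   are parent pointers of two rooted trees whose edge sets, seen as sets of crossings, are
   complementary.  It remains to see that the complement of a spanning tree T of the black graph is
   a spanning tree of the white graph.  It is connected: a cut of the white graph contained in T
   would meet every black region an even number of times, which is impossible at a deepest black
   region.  It has the right number of edges by Euler's formula. *)
theory Submission
  imports Defs
begin

section \<open>Rooted spanning trees of multigraphs\<close>

text \<open>Both sides are reduced to one object: a set of parent arcs with a numerical depth that
  grows along them. In a connected graph the depth is the distance from the root; in an acyclic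
  matching it comes from a potential decreasing along the arcs of the reversed poset graph.
  Conversely, the depths of two trees can be glued into one such potential.

  The remaining friction is orientation. A matched corner sits at the child end of its edge, whereas
  an arc away from the root is named by the corner at its parent end, so the two are translated by
  the involution \<open>opposite\<close>. Moreover, paths of the reversed poset graph run towards
  the root among black regions but away from it among white ones, so on one colour the potential is
  a depth and on the other its complement to a bound is.\<close>

definition spanning_arborescence :: "('a, 'b) pre_digraph \<Rightarrow> 'a \<Rightarrow> 'b set \<Rightarrow> bool" where
  "spanning_arborescence G r A \<longleftrightarrow>
     r \<in> verts G \<and> A \<subseteq> arcs G \<and> inj_on (head G) A \<and> head G ` A = verts G - {r} \<and>
     (\<exists>depth :: 'a \<Rightarrow> nat. \<forall>a\<in>A. depth (tail G a) < depth (head G a))"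

lemma (in wf_digraph) strongly_connected_imp_connected:
  assumes "strongly_connected G"
  shows "connected G"
  using assms reachable_mk_symmetricI unfolding connected_def strongly_connected_def by auto

section \<open>Potentials, shortest-path trees and parent arcs in finite digraphs\<close>

context fin_digraph
begin

text \<open>The number of vertices reachable by a nonempty walk is a potential when no vertex
  reaches itself; conversely a potential drops along every nonempty walk, so none can close
  up.\<close>

lemma no_cycle_iff_potential:
  "\<not> (\<exists>p. cycle p) \<longleftrightarrow> (\<exists>\<phi> :: 'a \<Rightarrow> nat. \<forall>a\<in>arcs G. \<phi> (head G a) < \<phi> (tail G a))"
proof
  assume acyclic: "\<not> (\<exists>p. cycle p)"
  have irrefl: "\<not> v \<rightarrow>\<^sup>+ v" for v
    using acyclic closed_w_imp_cycle by (auto simp: reachable1_awalk closed_w_def)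
  define \<phi> where "\<phi> v = card {u. v \<rightarrow>\<^sup>+ u}" for v
  have "\<phi> (head G a) < \<phi> (tail G a)" if "a \<in> arcs G" for a
  proof -
    have "{u. tail G a \<rightarrow>\<^sup>+ u} \<subseteq> verts G"
      by (auto simp: reachable1_awalk)
    then have "finite {u. tail G a \<rightarrow>\<^sup>+ u}"
      by (rule finite_subset) simp
    moreover have "tail G a \<rightarrow>\<^bsub>G\<^esub> head G a"
      using that by (rule in_arcs_imp_in_arcs_ends)
    \<comment> \<open>Strict: \<open>head G a\<close> lies in the right-hand set and, by acyclicity,
      not in the left-hand one.\<close>
    then have "{u. head G a \<rightarrow>\<^sup>+ u} \<subset> {u. tail G a \<rightarrow>\<^sup>+ u}"
      using irrefl by (auto intro: trancl_into_trancl2)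
    ultimately show ?thesis
      unfolding \<phi>_def by (rule psubset_card_mono)
  qed
  then show "\<exists>\<phi> :: 'a \<Rightarrow> nat. \<forall>a\<in>arcs G. \<phi> (head G a) < \<phi> (tail G a)" by blast
next
  assume "\<exists>\<phi> :: 'a \<Rightarrow> nat. \<forall>a\<in>arcs G. \<phi> (head G a) < \<phi> (tail G a)"
  then obtain \<phi> :: "'a \<Rightarrow> nat" where \<phi>: "\<And>a. a \<in> arcs G \<Longrightarrow> \<phi> (head G a) < \<phi> (tail G a)"
    by blast
  have "\<phi> v < \<phi> u" if "awalk u p v" "p \<noteq> []" for u p v
    using that
  proof (induction p arbitrary: u)
    case (Cons a p)
    then show ?case
      using \<phi>[of a] by (cases "p = []") (force simp: awalk_simps)+
  qed simp
  then show "\<not> (\<exists>p. cycle p)"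
    unfolding cycle_def by blast
qed

text \<open>Both are the set of visited vertices, because the start is also the head of the last
  arc.\<close>

lemma closed_awalk_tails_eq_heads:
  assumes "awalk u p u" "p \<noteq> []"
  shows "tail G ` set p = head G ` set p"
proof -
  have "cas u p u" using assms by blast
  then have tail_hd: "tail G (hd p) = u"
    using assms by (simp add: cas_simp)
  have "set (awalk_verts u p) = insert u (head G ` set p)"
    using assms \<open>cas u p u\<close> tail_hd by (simp add: awalk_verts_conv')
  moreover have "awlast u p = u" using assms by blast
  then have "head G (last p) = u"
    using assms by (simp add: awalk_verts_conv)
  then have "set (awalk_verts u p) = insert u (tail G ` set p)"
    using assms by (simp add: awalk_verts_conv)
  moreover have "u \<in> head G ` set p" "u \<in> tail G ` set p"
    using imageI[OF last_in_set[OF assms(2)], of "head G"] imageI[OF hd_in_set[OF assms(2)], of "tail G"]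
      \<open>head G (last p) = u\<close> tail_hd by simp_all
  ultimately show ?thesis by (simp add: insert_absorb)
qed

text \<open>The shortest-path tree: each vertex other than \<open>r\<close> selects the last arc of
  a shortest walk from \<open>r\<close>, with distance as depth.\<close>

lemma spanning_arborescence_exists:
  assumes "r \<in> verts G" and reach: "\<And>v. v \<in> verts G \<Longrightarrow> r \<rightarrow>\<^sup>* v"
  obtains A where "spanning_arborescence G r A"
proof -
  define dist where "dist v = (LEAST n. \<exists>p. awalk r p v \<and> length p = n)" for v
  have dist_le: "dist v \<le> length p" if "awalk r p v" for p v
    unfolding dist_def by (rule Least_le) (use that in blast)
  have shortest: "\<exists>p. awalk r p v \<and> length p = dist v" if v: "v \<in> verts G" for v
  proof -
    obtain p where "awalk r p v" using reach[OF v] by (auto simp: reachable_awalk)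
    then show ?thesis unfolding dist_def by (intro LeastI) blast
  qed
  have "\<exists>a\<in>arcs G. head G a = v \<and> dist (tail G a) < dist v" if v: "v \<in> verts G - {r}" for v
  proof -
    obtain p where p: "awalk r p v" "length p = dist v" using shortest v by blast
    with v have "p \<noteq> []" by (auto simp: awalk_simps)
    then obtain q a where "p = q @ [a]" by (cases p rule: rev_cases) auto
    with p have "a \<in> arcs G" "awalk r q (tail G a)" "head G a = v"
      by (auto simp: awalk_simps)
    with dist_le[of q] p \<open>p = q @ [a]\<close> show ?thesis by fastforce
  qed
  then obtain parent_arc where pa:
    "\<And>v. v \<in> verts G - {r} \<Longrightarrow> parent_arc v \<in> arcs G \<and> head G (parent_arc v) = v \<and>
       dist (tail G (parent_arc v)) < dist v" by metis
  have "spanning_arborescence G r (parent_arc ` (verts G - {r}))"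
    unfolding spanning_arborescence_def
  proof (intro conjI exI)
    show "\<forall>a\<in>parent_arc ` (verts G - {r}). dist (tail G a) < dist (head G a)"
      using pa by auto
    show "inj_on (head G) (parent_arc ` (verts G - {r}))"
      by (rule inj_onI) (use pa in force)
    show "head G ` parent_arc ` (verts G - {r}) = verts G - {r}"
      using pa by (simp add: image_image)
  qed (use assms pa in auto)
  then show thesis by (rule that)
qed

lemma spanning_arborescence_card:
  assumes "spanning_arborescence G r A"
  shows "card A = card (verts G) - 1"
proof -
  have "card A = card (head G ` A)"
    using assms by (intro card_image[symmetric]) (simp add: spanning_arborescence_def)
  also have "head G ` A = verts G - {r}" "r \<in> verts G"
    using assms by (simp_all add: spanning_arborescence_def)
  then have "card (head G ` A) = card (verts G) - 1"
    by simp
  finally show ?thesis .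
qed

lemma spanning_arborescence_apath:
  assumes "spanning_arborescence G r A" "v \<in> verts G"
  obtains p where "apath r p v" "set p \<subseteq> A"
proof -
  obtain depth :: "'a \<Rightarrow> nat" where A: "r \<in> verts G" "A \<subseteq> arcs G" "head G ` A = verts G - {r}"
    and depth: "\<And>a. a \<in> A \<Longrightarrow> depth (tail G a) < depth (head G a)"
    using assms unfolding spanning_arborescence_def by blast
  \<comment> \<open>The depth bound strengthens the induction so that the path stays simple: a
    vertex deeper than its parent cannot occur on the path to the parent.\<close>
  have "\<exists>p. apath r p v \<and> set p \<subseteq> A \<and> (\<forall>u\<in>set (awalk_verts r p). depth u \<le> depth v)"
    using assms(2)
  proof (induction "depth v" arbitrary: v rule: less_induct)
    case less
    show ?case
    proof (cases "v = r")
      case True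
      with A show ?thesis by (intro exI[of _ "[]"]) (auto simp: apath_simps)
    next
      case False
      with less.prems have "v \<in> head G ` A" using A(3) by simp
      then obtain a where a: "a \<in> A" "head G a = v" by blast
      then have "tail G a \<in> verts G" using A by auto
      from less.hyps[OF _ this] obtain p
        where p: "apath r p (tail G a)" "set p \<subseteq> A"
          "\<forall>u\<in>set (awalk_verts r p). depth u \<le> depth (tail G a)"
        using depth[of a] a by auto
      then have walk: "awalk r p (tail G a)" by (simp add: apath_def)
      then have last: "awlast r p = tail G a" by blast
      have "awalk (tail G a) [a] v" using a A by (auto simp: awalk_simps)
      moreover have "tail G a \<in> set (awalk_verts r p)"
        using last by (metis awalk_verts_non_Nil last_in_set)
      ultimately have verts: "set (awalk_verts r (p @ [a])) = insert v (set (awalk_verts r p))"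
        using set_awalk_verts_append[OF walk] a(2) by auto
      have "v \<notin> set (awalk_verts r p)" using p(3) depth[of a] a by auto
      then have "apath r (p @ [a]) v"
        using p(1) a A last depth[of a] by (auto simp: apath_append_iff apath_simps)
      moreover have "\<forall>u\<in>set (awalk_verts r (p @ [a])). depth u \<le> depth v"
        unfolding verts using p(3) depth[of a] a by auto
      ultimately show ?thesis using p(2) a(1) by (intro exI[of _ "p @ [a]"]) auto
    qed
  qed
  then show thesis using that by blast
qed

end

text \<open>An undirected multigraph given by two arcs per edge, swapped by \<open>reversal\<close>;
  \<open>edge\<close> names the common edge. It serves the Tait graphs of both colours, with
  crossings as edges.\<close>

locale loopfree_multigraph = fin_digraph G for G :: "('a, 'b) pre_digraph" (structure) +
  fixes reversal :: "'b \<Rightarrow> 'b" and edge :: "'b \<Rightarrow> 'c"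
  assumes reversal_in_arcs: "a \<in> arcs G \<Longrightarrow> reversal a \<in> arcs G"
    and tail_reversal: "a \<in> arcs G \<Longrightarrow> tail G (reversal a) = head G a"
    and head_reversal: "a \<in> arcs G \<Longrightarrow> head G (reversal a) = tail G a"
    and loopfree: "a \<in> arcs G \<Longrightarrow> tail G a \<noteq> head G a"
    and edge_eq_iff: "a \<in> arcs G \<Longrightarrow> b \<in> arcs G \<Longrightarrow> edge a = edge b \<longleftrightarrow> a = b \<or> a = reversal b"
begin

section \<open>Undirected trees inside their symmetric digraphs\<close>

lemma symmetric: "symmetric G"
  unfolding symmetric_conv using reversal_in_arcs tail_reversal head_reversal by metis

lemma awalk_reverse:
  assumes "awalk u p v"
  shows "awalk v (rev (map reversal p)) u"
  using assms
proof (induction p arbitrary: u)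
  case (Cons a p)
  then have "a \<in> arcs G" "u = tail G a" "awalk v (rev (map reversal p)) (head G a)"
    by (auto simp: awalk_Cons_iff)
  then show ?case
    by (auto simp: awalk_simps reversal_in_arcs tail_reversal head_reversal)
qed (simp add: awalk_simps)

text \<open>An arc and its reversal cannot both increase the depth.\<close>

lemma arborescence_edge_inj:
  assumes "spanning_arborescence G r A"
  shows "inj_on edge A"
proof (rule inj_onI)
  fix a b assume ab: "a \<in> A" "b \<in> A" "edge a = edge b"
  obtain depth :: "'a \<Rightarrow> nat" where A: "A \<subseteq> arcs G"
    and depth: "\<And>a. a \<in> A \<Longrightarrow> depth (tail G a) < depth (head G a)"
    using assms unfolding spanning_arborescence_def by blast
  show "a = b"
  proof (rule ccontr)
    assume "a \<noteq> b"
    with ab A have "a = reversal b" using edge_eq_iff by blast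
    then show False
      using depth[of a] depth[of b] ab A tail_reversal[of b] head_reversal[of b] by auto
  qed
qed

lemma arborescence_covers:
  assumes "spanning_arborescence G r A" "edge ` A = edge ` arcs G" "c \<in> arcs G"
  shows "c \<in> A \<or> reversal c \<in> A"
proof -
  obtain a where "a \<in> A" "edge a = edge c" using assms by (metis imageE imageI)
  moreover have "a \<in> arcs G" using assms(1) \<open>a \<in> A\<close> by (auto simp: spanning_arborescence_def)
  ultimately show ?thesis using edge_eq_iff assms(3) by blast
qed

text \<open>A simple path from the root that turned towards a parent would retrace the chosen arc by
  which it had just arrived. Hence the arcs pointing away from the root, defined by simple paths,
  are exactly the parent arcs.\<close>

lemma away_from_eq_arborescence:
  assumes A: "spanning_arborescence G r A" "edge ` A = edge ` arcs G"
  shows "away_from G r = A"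
proof
  have "set p \<subseteq> A" if "apath r p v" for p v
    using that
  proof (induction p arbitrary: v rule: rev_induct)
    case (snoc a p)
    have walk: "awalk r (p @ [a]) v" and "distinct (awalk_verts r (p @ [a]))"
      using snoc.prems by (auto simp: apath_def)
    then have dist: "distinct (map (tail G) p @ [tail G a, head G a])"
      by (simp add: awalk_verts_conv)
    from walk have p: "awalk r p (tail G a)" and a: "a \<in> arcs G"
      by (auto simp: awalk_simps)
    have "set p \<subseteq> A" using snoc by (auto simp: apath_append_iff)
    moreover have "a \<in> A"
    proof (rule ccontr)
      assume "a \<notin> A"
      then have ra: "reversal a \<in> A" using arborescence_covers[OF A] a by blast
      then have "tail G a \<noteq> r"
        using A(1) head_reversal[OF a] unfolding spanning_arborescence_def by blast
      then have "p \<noteq> []" using p by (auto simp: awalk_simps)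
      then obtain q b where q: "p = q @ [b]" by (cases p rule: rev_cases) auto
      with p have "head G b = head G (reversal a)"
        using head_reversal[OF a] by (auto simp: awalk_simps)
      moreover have "b \<in> A" using q \<open>set p \<subseteq> A\<close> by simp
      ultimately have "b = reversal a"
        using ra A(1) unfolding spanning_arborescence_def by (auto dest: inj_onD)
      then show False using dist q tail_reversal[OF a] by simp
    qed
    ultimately show ?case by simp
  qed simp
  then show "away_from G r \<subseteq> A" unfolding away_from_def by fastforce
next
  show "A \<subseteq> away_from G r"
  proof
    fix a assume a: "a \<in> A"
    then have arc: "a \<in> arcs G" using A by (auto simp: spanning_arborescence_def)
    obtain p where p: "apath r p (head G a)" "set p \<subseteq> A"
      using spanning_arborescence_apath[OF A(1) head_in_verts[OF arc]] by blast
    have "head G a \<noteq> r" using A(1) a unfolding spanning_arborescence_def by blast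
    then have "p \<noteq> []" using p by (auto simp: apath_simps)
    then obtain q b where q: "p = q @ [b]" by (cases p rule: rev_cases) auto
    have "awalk r p (head G a)" using p(1) by (simp add: apath_def)
    then have "head G b = head G a" unfolding q by (auto simp: awalk_simps)
    moreover have "b \<in> A" using p(2) q by simp
    ultimately have "b = a" using a A(1) unfolding spanning_arborescence_def by (auto dest: inj_onD)
    then show "a \<in> away_from G r" using p(1) q unfolding away_from_def by blast
  qed
qed

lemma arborescence_connected:
  assumes "spanning_arborescence G r A"
  shows "connected G"
proof -
  have reach: "r \<rightarrow>\<^sup>* v" if "v \<in> verts G" for v
    using spanning_arborescence_apath[OF assms that] by (auto simp: reachable_apath)
  have "u \<rightarrow>\<^sup>* v" if "u \<in> verts G" "v \<in> verts G" for u v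
    using reach that symmetric_reachable[OF symmetric] reachable_trans by blast
  moreover have "verts G \<noteq> {}" using assms by (auto simp: spanning_arborescence_def)
  ultimately have "strongly_connected G" by auto
  then show ?thesis by (rule strongly_connected_imp_connected)
qed

text \<open>The two arcs at a deepest vertex of a cycle both lie on the edge towards its parent.\<close>

lemma arborescence_no_cycle:
  assumes A: "spanning_arborescence G r A" "edge ` A = edge ` arcs G"
  shows "\<not> (\<exists>p. cycle p \<and> distinct (map edge p))"
proof
  assume "\<exists>p. cycle p \<and> distinct (map edge p)"
  then obtain u p where p: "awalk u p u" "p \<noteq> []" "inj_on edge (set p)"
    unfolding cycle_def by (auto simp: distinct_map)
  have arcs: "set p \<subseteq> arcs G" using p(1) by blast
  obtain depth :: "'a \<Rightarrow> nat" where inj: "inj_on (head G) A"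
    and depth: "\<And>a. a \<in> A \<Longrightarrow> depth (tail G a) < depth (head G a)"
    using A(1) unfolding spanning_arborescence_def by blast
  note ends = closed_awalk_tails_eq_heads[OF p(1,2)]
  define m where "m = Max ((\<lambda>a. depth (head G a)) ` set p)"
  have "m \<in> (\<lambda>a. depth (head G a)) ` set p"
    unfolding m_def using p(2) by (intro Max_in) auto
  then obtain a where a: "a \<in> set p" "depth (head G a) = m" by blast
  have heads: "depth (head G b) \<le> m" if "b \<in> set p" for b
    unfolding m_def using that by simp
  have tails: "depth (tail G b) \<le> m" if "b \<in> set p" for b
  proof -
    have "tail G b \<in> head G ` set p" using ends that by blast
    then show ?thesis using heads by auto
  qed
  obtain b where b: "b \<in> set p" "tail G b = head G a"
    using ends a(1) by (metis imageE imageI)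
  have "a \<in> arcs G" "b \<in> arcs G" using arcs a b by auto
  \<comment> \<open>Neither \<open>reversal a\<close> nor \<open>b\<close> can be chosen, since it
    would lead from the deepest vertex to a still deeper vertex of the cycle.\<close>
  have "a \<in> A"
    using arborescence_covers[OF A \<open>a \<in> arcs G\<close>] depth[of "reversal a"] tails[OF a(1)] a(2)
      tail_reversal[OF \<open>a \<in> arcs G\<close>] head_reversal[OF \<open>a \<in> arcs G\<close>] by auto
  moreover have "reversal b \<in> A"
    using arborescence_covers[OF A \<open>b \<in> arcs G\<close>] depth[of b] heads[OF b(1)] b(2) a(2) by auto
  moreover have "head G (reversal b) = head G a"
    using head_reversal[OF \<open>b \<in> arcs G\<close>] b(2) by simp
  ultimately have "a = reversal b" using inj by (auto dest: inj_onD)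
  then have "edge a = edge b" using edge_eq_iff \<open>a \<in> arcs G\<close> \<open>b \<in> arcs G\<close> by blast
  then have "a = b" using p(3) a(1) b(1) by (auto dest: inj_onD)
  then show False using b(2) loopfree[OF \<open>a \<in> arcs G\<close>] by simp
qed

lemma connected_arborescence_exists:
  assumes "connected G" "r \<in> verts G"
  obtains A where "spanning_arborescence G r A"
proof -
  have "strongly_connected G"
    using symmetric assms(1) by (rule symmetric_connected_imp_strongly_connected)
  then show thesis
    using assms(2) by (auto intro: spanning_arborescence_exists that)
qed

text \<open>An arborescence uses as many distinct edges as there are vertices other than the root,
  so with this edge count nothing is left over. Serves the dual tree, whose number of edges comes
  from Euler's formula.\<close>

lemma arborescence_covers_if_card:
  assumes A: "spanning_arborescence G r A" and card: "card (edge ` arcs G) = card (verts G) - 1"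
  shows "edge ` A = edge ` arcs G"
proof (rule card_subset_eq)
  show "edge ` A \<subseteq> edge ` arcs G" using A by (auto simp: spanning_arborescence_def)
  show "card (edge ` A) = card (edge ` arcs G)"
    using arborescence_edge_inj[OF A] spanning_arborescence_card[OF A] card by (simp add: card_image)
qed simp

text \<open>A second arc on the first edge would have the start of the path among its ends, and a
  simple path never returns there.\<close>

lemma apath_edges_distinct:
  assumes "apath u p v"
  shows "distinct (map edge p)"
  using assms
proof (induction p arbitrary: u)
  case (Cons a p)
  then have a: "a \<in> arcs G" and p: "apath (head G a) p v" "tail G a \<notin> set (awalk_verts (head G a) p)"
    by (auto simp: apath_Cons_iff)
  have "edge a \<noteq> edge b" if "b \<in> set p" for b
  proof
    assume "edge a = edge b"
    have walk: "awalk (head G a) p v" using p(1) by (simp add: apath_def)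
    with that have "b \<in> arcs G" by blast
    have "tail G b \<noteq> tail G a" "head G b \<noteq> tail G a"
      using awalk_verts_arc1[OF that] awalk_verts_arc2[of "head G a" p v b] walk that p(2) by auto
    with \<open>edge a = edge b\<close> show False
      using edge_eq_iff[OF a \<open>b \<in> arcs G\<close>] tail_reversal[OF \<open>b \<in> arcs G\<close>] by auto
  qed
  with Cons.IH[OF p(1)] show ?case by auto
qed simp

text \<open>An edge outside the arborescence closes a fundamental cycle: from its head up to the
  root and down to its tail along chosen edges.\<close>

lemma arborescence_covers_if_no_cycle:
  assumes A: "spanning_arborescence G r A"
    and no_cycle: "\<not> (\<exists>p. cycle p \<and> distinct (map edge p))"
  shows "edge ` A = edge ` arcs G"
proof (rule ccontr)
  have sub: "A \<subseteq> arcs G" using A by (auto simp: spanning_arborescence_def)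
  assume "edge ` A \<noteq> edge ` arcs G"
  then obtain c where c: "c \<in> arcs G" "edge c \<notin> edge ` A"
    using sub by blast
  obtain p where p: "apath r p (head G c)" "set p \<subseteq> A"
    using spanning_arborescence_apath[OF A head_in_verts[OF c(1)]] by blast
  obtain q where q: "apath r q (tail G c)" "set q \<subseteq> A"
    using spanning_arborescence_apath[OF A tail_in_verts[OF c(1)]] by blast
  \<comment> \<open>The two tree paths may overlap near the root; shortening their concatenation to
    a simple path removes repeated edges.\<close>
  define w where "w = awalk_to_apath (rev (map reversal p) @ q)"
  have walk: "awalk (head G c) (rev (map reversal p) @ q) (tail G c)"
    using awalk_reverse[OF awalkI_apath[OF p(1)]] awalkI_apath[OF q(1)] by (rule awalk_appendI)
  have path: "apath (head G c) w (tail G c)"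
    unfolding w_def using walk by (rule apath_awalk_to_apath)
  have "edge b \<in> edge ` A" if "b \<in> set w" for b
  proof -
    have "b \<in> reversal ` set p \<union> set q"
      using awalk_to_apath_subset[OF walk] that unfolding w_def by auto
    moreover have "edge (reversal a) = edge a" if "a \<in> set p" for a
      using that p(2) sub edge_eq_iff[of "reversal a" a] reversal_in_arcs[of a] by blast
    ultimately show ?thesis using p(2) q(2) by auto
  qed
  then have "distinct (map edge (c # w))"
    using c(2) apath_edges_distinct[OF path] by auto
  moreover have "cycle (c # w)"
    unfolding cycle_def using path c(1)
    by (intro exI[of _ "tail G c"]) (auto simp: apath_def awalk_Cons_iff)
  ultimately show False using no_cycle by blast
qed

end


section \<open>Reduced knot diagrams\<close>

lemma inj_on_Un_disjoint_images:
  "inj_on f A \<Longrightarrow> inj_on f B \<Longrightarrow> f ` A \<inter> f ` B = {} \<Longrightarrow> inj_on f (A \<union> B)"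
  unfolding inj_on_Un by blast

locale reduced_knot_diagram =
  fixes D :: "'d knot_projection"
  assumes diagram: "knot_diagram D" and reduced: "reduced D"
begin

abbreviation opposite :: "'d \<Rightarrow> 'd" where
  "opposite d \<equiv> rot D (rot D d)"

text \<open>The simplifier would loop on the chequerboard condition.\<close>

lemma finite_darts: "finite (darts D)"
  and rot_permutes: "rot D permutes darts D"
  and card_crossing_ball: "\<forall>d\<in>darts D. card (crossing D d) = 4"
  and opp_permutes: "opp D permutes darts D"
  and opp_ball: "\<forall>d\<in>darts D. opp D d \<noteq> d \<and> opp D (opp D d) = d"
  and one_component_ball: "\<forall>d\<in>darts D. orbit (rot D \<circ> rot D \<circ> opp D) d \<union>
    opp D ` orbit (rot D \<circ> rot D \<circ> opp D) d = darts D"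
  and euler: "card (crossings D) + card (regions D) = card (edges D) + 2"
  and black_subset: "black D \<subseteq> regions D"
  and chequerboard_ball: "\<forall>d\<in>darts D. region D d \<in> black D \<longleftrightarrow> region D (opp D d) \<notin> black D"
  using diagram[unfolded knot_diagram_def Let_def] by - (elim conjE, assumption)+

lemmas card_crossing = bspec[OF card_crossing_ball]
  and opp_neq = bspec[OF opp_ball, THEN conjunct1]
  and opp_opp = bspec[OF opp_ball, THEN conjunct2]
  and one_component = bspec[OF one_component_ball]
  and chequerboard = bspec[OF chequerboard_ball]

section \<open>Corners around a crossing and around a region\<close>

lemma rot_in_darts [simp]: "rot D d \<in> darts D \<longleftrightarrow> d \<in> darts D"
  and opp_in_darts [simp]: "opp D d \<in> darts D \<longleftrightarrow> d \<in> darts D"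
  using rot_permutes opp_permutes by (auto simp: permutes_in_image)

lemma region_step_permutes: "(opp D \<circ> rot D) permutes darts D"
  using rot_permutes opp_permutes by (rule permutes_compose)

lemma rot_cyclic:
  assumes "d \<in> darts D"
  shows "rot D (rot D (rot D (rot D d))) = d"
    and "distinct [d, rot D d, rot D (rot D d), rot D (rot D (rot D d))]"
    and "crossing D d = {d, rot D d, rot D (rot D d), rot D (rot D (rot D d))}"
proof -
  let ?n = "funpow_dist1 (rot D) d d"
  have self: "d \<in> orbit (rot D) d"
    using rot_permutes finite_darts by (intro permutation_self_in_orbit) (auto simp: permutation_permutes)
  have orbit: "crossing D d = (\<lambda>n. (rot D ^^ n) d) ` {0..<?n}"
    unfolding crossing_def by (rule orbit_conv_funpow_dist1[OF self])
  have inj: "inj_on (\<lambda>n. (rot D ^^ n) d) {0..<?n}"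
    using self by (rule inj_on_funpow_dist1)
  have "card (crossing D d) = 4"
    using assms by (rule card_crossing)
  then have n: "?n = 4"
    unfolding orbit using inj by (simp add: card_image)
  have "(rot D ^^ 4) d = d"
    using funpow_dist1_prop[OF self] unfolding n .
  then show "rot D (rot D (rot D (rot D d))) = d"
    by (simp add: eval_nat_numeral)
  have upto: "{0..<4} = {0, 1, 2, 3::nat}" by auto
  show "distinct [d, rot D d, rot D (rot D d), rot D (rot D (rot D d))]"
    using inj unfolding n upto by (simp add: eval_nat_numeral)
  show "crossing D d = {d, rot D d, rot D (rot D d), rot D (rot D (rot D d))}"
    unfolding orbit n upto by (simp add: eval_nat_numeral)
qed

lemma crossing_rot [simp]: "crossing D (rot D d) = crossing D d"
  unfolding crossing_def using rot_permutes finite_darts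
  by (intro permutation_orbit_step) (auto simp: permutation_permutes)

lemma crossing_eq:
  assumes "x \<in> crossing D d" "d \<in> darts D"
  shows "crossing D x = crossing D d"
proof -
  have "x \<in> {d, rot D d, rot D (rot D d), rot D (rot D (rot D d))}"
    using assms rot_cyclic(3) by blast
  then show ?thesis by (elim insertE emptyE) simp_all
qed

lemma region_step [simp]: "region D (opp D (rot D d)) = region D d"
proof -
  have "permutation (opp D \<circ> rot D)"
    using region_step_permutes finite_darts by (auto simp: permutation_permutes)
  from permutation_orbit_step[OF this, of d] show ?thesis by (simp add: region_def)
qed

lemma self_in_region: "d \<in> region D d"
  unfolding region_def using region_step_permutes finite_darts
  by (intro permutation_self_in_orbit) (auto simp: permutation_permutes)

text \<open>Three rotations are one step back, to the corner on the other side of the edge of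
  \<open>d\<close>.\<close>

lemma region_opp:
  assumes "d \<in> darts D"
  shows "region D (opp D d) = region D (rot D (rot D (rot D d)))"
  using region_step[of "rot D (rot D (rot D d))"] rot_cyclic(1)[OF assms] by simp

lemma region_in_regions: "d \<in> darts D \<Longrightarrow> region D d \<in> regions D"
  and crossing_in_crossings: "d \<in> darts D \<Longrightarrow> crossing D d \<in> crossings D"
  by (auto simp: regions_def crossings_def)

lemma finite_regions: "finite (regions D)"
  and finite_crossings: "finite (crossings D)"
  using finite_darts by (auto simp: regions_def crossings_def)

lemma regions_split: "regions D = black D \<union> white D" "black D \<inter> white D = {}"
  using black_subset by (auto simp: white_def)

lemma region_rot_black:
  assumes "d \<in> darts D"
  shows "region D (rot D d) \<in> black D \<longleftrightarrow> region D d \<notin> black D"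
  using chequerboard[of "rot D d"] assms by simp

section \<open>The two colour classes and their Tait graphs, treated uniformly\<close>

definition colour :: "'d set set \<Rightarrow> bool" where
  "colour R \<longleftrightarrow> R = black D \<or> R = white D"

lemma colour_black: "colour (black D)" and colour_white: "colour (white D)"
  by (simp_all add: colour_def)

lemma colour_subset: "colour R \<Longrightarrow> R \<subseteq> regions D"
  using black_subset by (auto simp: colour_def white_def)

lemma region_white_iff: "d \<in> darts D \<Longrightarrow> region D d \<in> white D \<longleftrightarrow> region D d \<notin> black D"
  by (simp add: white_def region_in_regions)

lemma region_rot_colour:
  assumes "colour R" "d \<in> darts D"
  shows "region D (rot D d) \<in> R \<longleftrightarrow> region D d \<notin> R"
  using assms region_rot_black by (auto simp: colour_def region_white_iff)

lemma region_opposite_colour: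
  assumes "colour R" "d \<in> darts D"
  shows "region D (opposite d) \<in> R \<longleftrightarrow> region D d \<in> R"
  using assms by (simp add: region_rot_colour)

text \<open>Colours alternate around a crossing, leaving only the opposite corner. This identifies
  the two arcs of an edge of a Tait graph.\<close>

lemma same_crossing_same_colour:
  assumes "colour R" "a \<in> darts D" "b \<in> darts D" "region D a \<in> R" "region D b \<in> R"
  shows "crossing D a = crossing D b \<longleftrightarrow> a = b \<or> a = opposite b"
proof
  assume "crossing D a = crossing D b"
  then have "a \<in> {b, rot D b, opposite b, rot D (opposite b)}"
    using rot_cyclic(3)[OF assms(2)] rot_cyclic(3)[OF assms(3)] by blast
  then show "a = b \<or> a = opposite b"
    using assms region_rot_colour[OF assms(1)] by auto
qed auto

lemma opposite_opposite: "d \<in> darts D \<Longrightarrow> opposite (opposite d) = d"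
  by (rule rot_cyclic(1))

lemma opposite_neq: "d \<in> darts D \<Longrightarrow> opposite d \<noteq> d"
  using rot_cyclic(2) by fastforce

text \<open>Here reducedness enters: it excludes loops in the Tait graphs.\<close>

lemma region_opposite_neq:
  assumes "d \<in> darts D"
  shows "region D (opposite d) \<noteq> region D d"
proof -
  have "inj_on (region D) (crossing D d)"
    using reduced assms by (simp add: reduced_def crossings_def)
  then show ?thesis
    using rot_cyclic(3)[OF assms] opposite_neq[OF assms] by (auto dest: inj_onD)
qed

lemma tait_simps [simp]:
  "verts (tait_graph D R X) = R"
  "tail (tait_graph D R X) = region D"
  "head (tait_graph D R X) = (\<lambda>d. region D (opposite d))"
  "a \<in> arcs (tait_graph D R X) \<longleftrightarrow> a \<in> darts D \<and> region D a \<in> R \<and> crossing D a \<in> X"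
  by (auto simp: tait_graph_def)

lemma tait_multigraph:
  assumes "colour R"
  shows "loopfree_multigraph (tait_graph D R X) (\<lambda>d. opposite d) (crossing D)"
proof
  show "finite (verts (tait_graph D R X))"
    using colour_subset[OF assms] finite_regions by (auto intro: finite_subset)
  show "finite (arcs (tait_graph D R X))"
    by (rule finite_subset[OF _ finite_darts]) auto
qed (use assms region_opposite_neq in \<open>auto simp: region_rot_colour opposite_opposite same_crossing_same_colour\<close>)

lemma tait_edges:
  assumes "colour R" "X \<subseteq> crossings D"
  shows "crossing D ` arcs (tait_graph D R X) = X"
proof
  show "X \<subseteq> crossing D ` arcs (tait_graph D R X)"
  proof
    fix c assume c: "c \<in> X"
    then obtain d where d: "d \<in> darts D" "c = crossing D d"
      using assms(2) by (auto simp: crossings_def)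
    then have "region D d \<in> R \<or> region D (rot D d) \<in> R"
      using region_rot_colour[OF assms(1)] by blast
    then show "c \<in> crossing D ` arcs (tait_graph D R X)"
    proof
      assume "region D d \<in> R"
      then show ?thesis using c d by (intro image_eqI[of _ _ d]) auto
    next
      assume "region D (rot D d) \<in> R"
      then show ?thesis using c d by (intro image_eqI[of _ _ "rot D d"]) auto
    qed
  qed
qed auto

text \<open>Counting darts at crossings and on edges gives 4V = 2E, so Euler's formula becomes F = V
  + 2: exactly as many crossings as two trees spanning the black and the white regions need.\<close>

lemma card_crossings_regions:
  shows "card (black D) + card (white D) = card (crossings D) + 2"
proof -
  have "4 * card (crossings D) = card (\<Union> (crossings D))"
  proof (rule card_partition)
    show "finite (\<Union> (crossings D))"
      using finite_darts rot_cyclic(3) by (auto simp: crossings_def)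
    show "card c = 4" if "c \<in> crossings D" for c
      using that card_crossing by (auto simp: crossings_def)
    show "c \<inter> c' = {}" if "c \<in> crossings D" "c' \<in> crossings D" "c \<noteq> c'" for c c'
      using that crossing_eq unfolding crossings_def by blast
  qed (rule finite_crossings)
  moreover have "\<Union> (crossings D) = darts D"
    using rot_cyclic(3) by (auto simp: crossings_def)
  moreover have "2 * card (edges D) = card (\<Union> (edges D))"
  proof (rule card_partition)
    show "finite (edges D)" "finite (\<Union> (edges D))"
      using finite_darts by (auto simp: edges_def)
    show "card e = 2" if "e \<in> edges D" for e
      using that opp_neq by (fastforce simp: edges_def card_2_iff)
    show "e \<inter> e' = {}" if e: "e \<in> edges D" "e' \<in> edges D" "e \<noteq> e'" for e e'
    proof (rule ccontr)
      obtain d d' where d: "d \<in> darts D" "e = {d, opp D d}" "d' \<in> darts D" "e' = {d', opp D d'}"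
        using e(1,2) by (auto simp: edges_def)
      assume "e \<inter> e' \<noteq> {}"
      with d have "d = d' \<or> d = opp D d' \<or> opp D d = d' \<or> opp D d = opp D d'" by blast
      then have "d = d' \<or> d = opp D d'" using opp_opp d by metis
      then show False using d \<open>e \<noteq> e'\<close> opp_opp by auto
    qed
  qed
  moreover have "\<Union> (edges D) = darts D"
    by (auto simp: edges_def)
  moreover note euler
  moreover have "card (regions D) = card (black D) + card (white D)"
    using regions_split finite_regions by (simp add: card_Un_disjoint)
  ultimately show ?thesis by simp
qed


subsection \<open>Duality of spanning trees\<close>

text \<open>The crossings \<open>X\<close> are the edges of a tree spanning \<open>R\<close>, and
  \<open>A\<close> is its orientation away from \<open>r\<close>. The second conjunct forces the
  arborescence to exhaust \<open>X\<close>, which rules out further edges.\<close>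

abbreviation rooted_tait :: "'d set set \<Rightarrow> 'd set set \<Rightarrow> 'd set \<Rightarrow> 'd set \<Rightarrow> bool" where
  "rooted_tait R X r A \<equiv> spanning_arborescence (tait_graph D R X) r A \<and> crossing D ` A = X"

lemma rooted_tait_away_from:
  assumes R: "colour R" and A: "rooted_tait R X r A" and X: "X \<subseteq> crossings D"
  shows "away_from (tait_graph D R X) r = A"
proof -
  interpret loopfree_multigraph "tait_graph D R X" "\<lambda>d. opposite d" "crossing D"
    using R by (rule tait_multigraph)
  show ?thesis
    using A by (intro away_from_eq_arborescence) (simp_all only: tait_edges[OF R X])
qed

lemma rooted_tait_spanning_tree:
  assumes R: "colour R" and A: "rooted_tait R X r A" and X: "X \<subseteq> crossings D"
  shows "X \<in> spanning_trees D R"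
proof -
  interpret loopfree_multigraph "tait_graph D R X" "\<lambda>d. opposite d" "crossing D"
    using R by (rule tait_multigraph)
  have "spanning_arborescence (tait_graph D R X) r A" using A by (rule conjunct1)
  moreover have "crossing D ` A = crossing D ` arcs (tait_graph D R X)"
    using A by (simp only: tait_edges[OF R X])
  ultimately have "connected (tait_graph D R X) \<and> \<not> (\<exists>p. cycle p \<and> distinct (map (crossing D) p))"
    by (intro conjI arborescence_connected arborescence_no_cycle)
  with X show ?thesis
    unfolding spanning_trees_def by (intro CollectI conjI) blast+
qed

lemma spanning_tree_rooted_tait:
  assumes R: "colour R" and tree: "T \<in> spanning_trees D R" and "r \<in> R"
  obtains A where "rooted_tait R T r A"
proof -
  interpret loopfree_multigraph "tait_graph D R T" "\<lambda>d. opposite d" "crossing D"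
    using R by (rule tait_multigraph)
  have T: "T \<subseteq> crossings D" "connected (tait_graph D R T)"
    "\<not> (\<exists>p. cycle p \<and> distinct (map (crossing D) p))"
    using tree unfolding spanning_trees_def by blast+
  have "r \<in> verts (tait_graph D R T)" using \<open>r \<in> R\<close> by simp
  then obtain A where A: "spanning_arborescence (tait_graph D R T) r A"
    by (rule connected_arborescence_exists[OF T(2)])
  moreover have "crossing D ` A = T"
    using arborescence_covers_if_no_cycle[OF A T(3)] by (simp only: tait_edges[OF R T(1)])
  ultimately show thesis using that by blast
qed

lemma rooted_tait_card:
  assumes R: "colour R" and A: "rooted_tait R X r A"
  shows "card X = card R - 1"
proof -
  interpret loopfree_multigraph "tait_graph D R X" "\<lambda>d. opposite d" "crossing D"
    using R by (rule tait_multigraph)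
  have arborescence: "spanning_arborescence (tait_graph D R X) r A" using A by (rule conjunct1)
  have "card (crossing D ` A) = card A"
    using arborescence_edge_inj[OF arborescence] by (rule card_image)
  then show ?thesis
    using A spanning_arborescence_card[OF arborescence] by simp
qed

text \<open>
  Let \<open>S\<close> be closed under the complementary edges.  The edges of the dual graph leaving \<open>S\<close> are
  duals of edges in \<open>T\<close>, and around each black region their number is even, as membership in \<open>S\<close>
  changes at exactly these crossings.  But a black region that is deepest among the ends of such
  edges meets exactly one of them.
\<close>

lemma cut_of_rooted_tait_trivial:
  assumes tree: "rooted_tait (black D) T r A"
    and closed: "\<And>d. d \<in> darts D \<Longrightarrow> region D d \<in> white D \<Longrightarrow> crossing D d \<notin> T \<Longrightarrow>
      region D d \<in> S \<longleftrightarrow> region D (opposite d) \<in> S"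
    and d: "d \<in> darts D" "region D d \<in> white D"
  shows "region D d \<in> S \<longleftrightarrow> region D (opposite d) \<in> S"
proof (rule ccontr)
  assume split_d: "\<not> ?thesis"
  interpret loopfree_multigraph "tait_graph D (black D) T" "\<lambda>d. opposite d" "crossing D"
    using colour_black by (rule tait_multigraph)
  \<comment> \<open>For a black corner \<open>a\<close>, the corners \<open>rot D a\<close> and
    \<open>rot D (opposite a)\<close> are the two white ones at its crossing: \<open>split a\<close>
    says that the dual edge leaves \<open>S\<close>.\<close>
  define split where
    "split a \<longleftrightarrow> (region D (rot D a) \<in> S \<longleftrightarrow> region D (rot D (opposite a)) \<notin> S)" for a
  have arborescence: "spanning_arborescence (tait_graph D (black D) T) r A"
    and T: "crossing D ` A = T" using tree by auto
  have arcs: "A \<subseteq> arcs (tait_graph D (black D) T)"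
    and inj: "inj_on (\<lambda>d. region D (opposite d)) A"
    using arborescence by (auto simp: spanning_arborescence_def)
  have A: "A \<subseteq> darts D" "\<And>a. a \<in> A \<Longrightarrow> region D a \<in> black D"
    using arcs by (auto simp: tait_graph_def)
  obtain depth :: "'d set \<Rightarrow> nat" where
    depth: "\<And>a. a \<in> A \<Longrightarrow> depth (region D a) < depth (region D (opposite a))"
    using arborescence unfolding spanning_arborescence_def tait_simps by meson
  have edges: "crossing D ` A = crossing D ` arcs (tait_graph D (black D) T)"
    using arcs T by (auto simp: tait_graph_def)
  \<comment> \<open>A cut edge lies in \<open>T\<close> because \<open>S\<close> is closed under the
    complementary edges, so one of its arcs is chosen.\<close>
  have split_in_A: "z \<in> A \<or> opposite z \<in> A"
    if "z \<in> darts D" "region D z \<in> black D" "split z" for z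
  proof -
    have "region D (rot D z) \<in> white D"
      using that by (simp add: region_rot_black region_white_iff)
    then have "crossing D z \<in> T"
      using closed[of "rot D z"] that by (auto simp: split_def)
    then show ?thesis
      using that by (intro arborescence_covers[OF arborescence edges]) auto
  qed
  have split_opposite: "split (opposite z) \<longleftrightarrow> split z" if "z \<in> darts D" for z
    using that by (auto simp: split_def opposite_opposite)
  define e where "e = rot D d"
  have "rot D (rot D e) = rot D (opposite d)" "rot D (opposite e) = d"
    using rot_cyclic(1)[OF d(1)] by (simp_all add: e_def)
  then have e: "e \<in> darts D" "region D e \<in> black D" "split e"
    using d split_d region_rot_black region_white_iff by (auto simp: e_def split_def)
  then have "{a \<in> A. split a} \<noteq> {}"
    using split_in_A split_opposite by blast
  moreover have "finite {a \<in> A. split a}"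
    using A(1) finite_darts by (auto intro: finite_subset)
  ultimately obtain a where "a \<in> {a \<in> A. split a}"
    and a_max: "depth (region D (opposite a)) = Max ((\<lambda>a. depth (region D (opposite a))) ` {a \<in> A. split a})"
    by (metis (no_types, lifting) obtains_MAX)
  then have a: "a \<in> A" "split a" by auto
  have deepest: "depth (region D (opposite z)) \<le> depth (region D (opposite a))"
    if "z \<in> A" "split z" for z
    unfolding a_max using that \<open>finite {a \<in> A. split a}\<close> by (intro Max_ge) auto
  have "a \<in> darts D" using a A by blast
  \<comment> \<open>The corner at the child end of \<open>a\<close>: the tour around the deepest
    region starts at the edge to its parent.\<close>
  define x where "x = opposite a"
  have x: "x \<in> darts D" "region D x \<in> black D" "split x" "opposite x = a"
    using a A \<open>a \<in> darts D\<close> split_opposite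
    by (auto simp: x_def opposite_opposite region_opposite_colour[OF colour_black])
  let ?f = "\<lambda>y. region D (rot D y) \<in> S"
  let ?next = "opp D \<circ> rot D"
  \<comment> \<open>Consecutive corners \<open>y\<close> and \<open>?next y\<close> of a black
    region share an edge, with one white region on its other side.\<close>
  have before: "region D (rot D (opposite (?next y))) = region D (rot D y)" if "y \<in> darts D" for y
    using region_opp[of "?next y"] opp_opp[of "rot D y"] that by simp
  \<comment> \<open>If \<open>?next y\<close> were split, its tree edge would lead either to a
    deeper region, against the choice of \<open>a\<close>, or to the parent, which happens only at
    \<open>x\<close>.\<close>
  have unsplit: "?f (?next y) \<longleftrightarrow> ?f y"
    if y: "y \<in> darts D" "region D y = region D x" "?next y \<noteq> x" for y
  proof (rule ccontr)
    assume "\<not> ?thesis"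
    then have "split (?next y)"
      using before[OF y(1)] by (auto simp: split_def)
    moreover have next_y: "?next y \<in> darts D" "region D (?next y) = region D x"
      using y by auto
    ultimately have "?next y \<in> A \<or> opposite (?next y) \<in> A"
      using split_in_A x(2) by metis
    then show False
    proof
      assume "?next y \<in> A"
      then show False
        using deepest[of "?next y"] depth[of "?next y"] \<open>split (?next y)\<close> next_y(2)
        by (simp add: x_def)
    next
      assume "opposite (?next y) \<in> A"
      moreover have "region D (opposite (opposite (?next y))) = region D (opposite a)"
        using opposite_opposite[OF next_y(1)] next_y(2) by (simp add: x_def)
      ultimately have "opposite (?next y) = a"
        using inj a(1) by (auto dest: inj_onD)
      then show False
        using opposite_opposite[OF next_y(1)] y(3) by (simp add: x_def)
    qed
  qed
  have f_eq: "?f y \<longleftrightarrow> ?f x" and in_region: "y \<in> darts D \<and> region D y = region D x"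
    if "y \<in> orbit ?next x" for y
  proof -
    have "(?f y \<longleftrightarrow> ?f x) \<and> y \<in> darts D \<and> region D y = region D x"
      using that
    proof induction
      case base
      then show ?case using unsplit[of x] x(1) by (cases "?next x = x") auto
    next
      case (step y)
      then show ?case using unsplit[of y] by (cases "?next y = x") auto
    qed
    then show "?f y \<longleftrightarrow> ?f x" "y \<in> darts D \<and> region D y = region D x" by auto
  qed
  have "x \<in> orbit ?next x"
    using self_in_region[of x] by (simp add: region_def)
  \<comment> \<open>The tour closes up at the predecessor \<open>y\<close> of \<open>x\<close>:
    membership in \<open>S\<close> is then the same just before and just after \<open>x\<close>,
    although \<open>x\<close> is split.\<close>
  then obtain y where y: "y \<in> orbit ?next x" "?next y = x"
    by (metis orbit.cases)
  then have "region D (rot D (opposite x)) = region D (rot D y)"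
    using before[of y] in_region by simp
  then show False
    using f_eq[OF y(1)] x(3) by (simp add: split_def)
qed

text \<open>The single strand of the knot visits every edge, and the white region beside it changes,
  if at all, to the one at the opposite corner of a crossing.\<close>

lemma white_regions_connected:
  assumes closed: "\<And>d. d \<in> darts D \<Longrightarrow> region D d \<in> white D \<Longrightarrow>
      region D d \<in> S \<longleftrightarrow> region D (opposite d) \<in> S"
    and "u \<in> white D" "v \<in> white D" "u \<in> S"
  shows "v \<in> S"
proof -
  \<comment> \<open>The white one of the two regions along the edge of \<open>d\<close>.\<close>
  define side where "side d = (if region D d \<in> white D then region D d else region D (opp D d))" for d
  have side_opp: "side (opp D d) = side d" if "d \<in> darts D" for d
    using that chequerboard[OF that] by (auto simp: side_def opp_opp region_white_iff)
  \<comment> \<open>Across a white corner the two darts share their white region; across a black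
    corner their white regions are opposite at the crossing.\<close>
  have side_rot: "side (rot D d) \<in> S \<longleftrightarrow> side d \<in> S" if d: "d \<in> darts D" for d
  proof (cases "region D d \<in> white D")
    case True
    then show ?thesis using d by (simp add: side_def region_rot_colour[OF colour_white])
  next
    case False
    then have "region D (rot D d) \<in> white D"
      using d by (simp add: region_rot_colour[OF colour_white])
    then show ?thesis
      using False d closed[of "rot D d"] by (simp add: side_def region_opp)
  qed
  obtain d e where d: "d \<in> darts D" "u = region D d" and e: "e \<in> darts D" "v = region D e"
    using assms(2,3) by (auto simp: white_def regions_def)
  have orbit: "x \<in> darts D \<and> (side x \<in> S \<longleftrightarrow> side d \<in> S)"
    if "x \<in> orbit (rot D \<circ> rot D \<circ> opp D) d" for x
    using that by induction (auto simp: side_rot side_opp d(1))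
  have "e \<in> orbit (rot D \<circ> rot D \<circ> opp D) d \<union> opp D ` orbit (rot D \<circ> rot D \<circ> opp D) d"
    using one_component[OF d(1)] e(1) by simp
  then have "side e \<in> S \<longleftrightarrow> side d \<in> S"
    using orbit side_opp by auto
  then show ?thesis
    using assms d e by (simp add: side_def)
qed

text \<open>No complementary edge leaves the set of regions reachable from \<open>u\<close>; the cut
  argument extends this to all white edges, so the set is everything.\<close>

lemma dual_connected:
  assumes tree: "rooted_tait (black D) T r A" and "w \<in> white D"
  shows "connected (tait_graph D (white D) (crossings D - T))"
proof -
  let ?G = "tait_graph D (white D) (crossings D - T)"
  interpret loopfree_multigraph ?G "\<lambda>d. opposite d" "crossing D"
    using colour_white by (rule tait_multigraph)
  have "u \<rightarrow>\<^sup>*\<^bsub>?G\<^esub> v" if "u \<in> white D" "v \<in> white D" for u v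
  proof -
    let ?S = "{v. u \<rightarrow>\<^sup>*\<^bsub>?G\<^esub> v}"
    have step: "region D (opposite d) \<in> ?S"
      if "d \<in> darts D" "region D d \<in> white D" "crossing D d \<notin> T" "region D d \<in> ?S" for d
    proof -
      have "d \<in> arcs ?G" using that by (simp add: crossing_in_crossings)
      from in_arcs_imp_in_arcs_ends[OF this]
      have "region D d \<rightarrow>\<^bsub>?G\<^esub> region D (opposite d)" by simp
      then show ?thesis using that(4) by (auto intro: reachable_adj_trans)
    qed
    have closed: "region D d \<in> ?S \<longleftrightarrow> region D (opposite d) \<in> ?S"
      if "d \<in> darts D" "region D d \<in> white D" "crossing D d \<notin> T" for d
      using step[of d] step[of "opposite d"] that
      by (auto simp: opposite_opposite region_rot_colour[OF colour_white])
    have "v \<in> ?S"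
      using cut_of_rooted_tait_trivial[OF tree closed] that
      by (intro white_regions_connected[of ?S u v]) auto
    then show ?thesis by simp
  qed
  then have "strongly_connected ?G" using assms(2) by auto
  then show ?thesis by (rule strongly_connected_imp_connected)
qed

lemma dual_rooted_tait:
  assumes tree: "rooted_tait (black D) T r A" and "T \<subseteq> crossings D" "w \<in> white D"
  obtains B where "rooted_tait (white D) (crossings D - T) w B"
proof -
  let ?G = "tait_graph D (white D) (crossings D - T)"
  interpret loopfree_multigraph ?G "\<lambda>d. opposite d" "crossing D"
    using colour_white by (rule tait_multigraph)
  obtain B where B: "spanning_arborescence ?G w B"
    using connected_arborescence_exists[OF dual_connected[OF tree assms(3)]] assms(3) by auto
  have edges: "crossing D ` arcs ?G = crossings D - T"
    using tait_edges[OF colour_white] by blast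
  have "r \<in> black D"
    using tree by (simp add: spanning_arborescence_def)
  moreover have "finite (black D)"
    using black_subset finite_regions by (rule finite_subset)
  \<comment> \<open>Guards the truncated subtraction in the edge count of \<open>T\<close>.\<close>
  ultimately have "card (black D) > 0"
    by (auto simp: card_gt_0_iff)
  then have "card (crossings D - T) = card (white D) - 1"
    using assms(2) card_crossings_regions rooted_tait_card[OF colour_black tree] finite_crossings
    by (simp add: card_Diff_subset finite_subset)
  then have "crossing D ` B = crossings D - T"
    using arborescence_covers_if_card[OF B] edges by simp
  then show thesis using B that by blast
qed


subsection \<open>Perfect discrete Morse functions\<close>

lemma poset_simps [simp]:
  "verts (poset_graph D) = Region ` regions D \<union> Crossing ` crossings D"
  "arcs (poset_graph D) = darts D"
  "ends (poset_graph D) d = {Region (region D d), Crossing (crossing D d)}"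
  by (auto simp: poset_graph_def ends_def)

lemma poset_matching_iff:
  "is_matching (poset_graph D) M \<longleftrightarrow>
     M \<subseteq> darts D \<and> inj_on (region D) M \<and> inj_on (crossing D) M"
  by (auto simp: is_matching_def inj_on_def)

lemma poset_unmatched:
  "unmatched (poset_graph D) M =
     Region ` (regions D - region D ` M) \<union> Crossing ` (crossings D - crossing D ` M)"
  by (auto simp: unmatched_def)

lemma poset_fin_digraph: "fin_digraph (reverse_arcs (poset_graph D) M)"
  using finite_darts finite_regions finite_crossings
  by unfold_locales
    (auto simp: reverse_arcs_def poset_graph_def region_in_regions crossing_in_crossings)

text \<open>In the reversed graph, matched black corners and unmatched white corners are the arcs
  from region to crossing; all other corners are arcs from crossing to region.\<close>

lemma poset_acyclic_iff_potential:
  "\<not> (\<exists>p. pre_digraph.cycle (reverse_arcs (poset_graph D) M) p) \<longleftrightarrow>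
     (\<exists>\<phi> :: 'd cell \<Rightarrow> nat. \<forall>d\<in>darts D.
        if region D d \<in> black D \<longleftrightarrow> d \<in> M
        then \<phi> (Crossing (crossing D d)) < \<phi> (Region (region D d))
        else \<phi> (Region (region D d)) < \<phi> (Crossing (crossing D d)))"
proof -
  interpret fin_digraph "reverse_arcs (poset_graph D) M" by (rule poset_fin_digraph)
  show ?thesis
    unfolding no_cycle_iff_potential
    by (intro ex_cong1 ball_cong) (auto simp: reverse_arcs_def poset_graph_def)
qed

text \<open>\<open>N\<close> consists of parent pointers: the corner \<open>d\<close> lies at the
  child and \<open>opposite d\<close> at the parent, so applying \<open>opposite\<close> yields arcs
  leading away from \<open>r\<close>.\<close>

lemma rooted_tait_opposite:
  assumes R: "colour R" and "r \<in> R" and N: "N \<subseteq> darts D"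
    and regions: "region D ` N = R - {r}" "inj_on (region D) N"
    and depth: "\<And>d. d \<in> N \<Longrightarrow> depth (region D (opposite d)) < (depth (region D d) :: nat)"
  shows "rooted_tait R (crossing D ` N) r (opposite ` N)"
proof
  have opp2: "region D (opposite (opposite d)) = region D d" if "d \<in> N" for d
    using that N opposite_opposite by (metis subsetD)
  show "crossing D ` opposite ` N = crossing D ` N" by (simp add: image_image)
  show "spanning_arborescence (tait_graph D R (crossing D ` N)) r (opposite ` N)"
    unfolding spanning_arborescence_def
  proof (intro conjI exI ballI)
    show "opposite ` N \<subseteq> arcs (tait_graph D R (crossing D ` N))"
      using N regions(1) region_opposite_colour[OF R] by fastforce
    show "inj_on (head (tait_graph D R (crossing D ` N))) (opposite ` N)"
      using regions(2) opp2 by (auto simp: inj_on_def)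
    have "head (tait_graph D R (crossing D ` N)) ` opposite ` N = region D ` N"
      unfolding image_image using opp2 by (intro image_cong) auto
    then show "head (tait_graph D R (crossing D ` N)) ` opposite ` N =
        verts (tait_graph D R (crossing D ` N)) - {r}"
      using regions(1) by simp
    fix a assume "a \<in> opposite ` N"
    then show "depth (tail (tait_graph D R (crossing D ` N)) a) <
        depth (head (tait_graph D R (crossing D ` N)) a)"
      using depth opp2 by auto
  qed (simp add: \<open>r \<in> R\<close>)
qed

text \<open>Back to pointers at the child ends. Uniqueness of the entering arc makes them injective
  on regions; growth of depth, allowing one arc per edge, makes them injective on crossings.\<close>

lemma rooted_taitE:
  assumes R: "colour R" and A: "rooted_tait R X r A"
  obtains depth :: "'d set \<Rightarrow> nat" and N where
    "N \<subseteq> darts D" "A = opposite ` N" "crossing D ` N = X" "inj_on (crossing D) N"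
    "region D ` N = R - {r}" "inj_on (region D) N"
    "\<And>d. d \<in> N \<Longrightarrow> depth (region D (opposite d)) < depth (region D d)"
proof -
  let ?G = "tait_graph D R X"
  interpret loopfree_multigraph ?G "\<lambda>d. opposite d" "crossing D"
    using R by (rule tait_multigraph)
  have arborescence: "spanning_arborescence ?G r A" and X: "crossing D ` A = X" using A by auto
  have sub: "A \<subseteq> darts D" and inj: "inj_on (\<lambda>d. region D (opposite d)) A"
    and heads: "(\<lambda>d. region D (opposite d)) ` A = R - {r}"
    using arborescence by (auto simp: spanning_arborescence_def tait_graph_def)
  obtain depth :: "'d set \<Rightarrow> nat" where
    depth: "\<And>a. a \<in> A \<Longrightarrow> depth (region D a) < depth (region D (opposite a))"
    using arborescence unfolding spanning_arborescence_def tait_simps by meson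
  note edge_inj = arborescence_edge_inj[OF arborescence]
  show thesis
  proof (rule that)
    show "opposite ` A \<subseteq> darts D" using sub by auto
    show "A = opposite ` opposite ` A"
      using sub opposite_opposite by (simp add: image_image subset_iff cong: image_cong_simp)
    show "crossing D ` opposite ` A = X" using X by (simp add: image_image)
    show "inj_on (crossing D) (opposite ` A)" using edge_inj by (auto simp: inj_on_def)
    show "region D ` opposite ` A = R - {r}" using heads by (simp add: image_image)
    show "inj_on (region D) (opposite ` A)" using inj by (auto simp: inj_on_def)
    show "depth (region D (opposite d)) < depth (region D d)" if "d \<in> opposite ` A" for d
      using that sub depth opposite_opposite by (auto simp: subset_iff)
  qed
qed

lemma rooted_taits_perfect:
  assumes T: "T \<subseteq> crossings D"
    and A: "rooted_tait (black D) T b A"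
    and B: "rooted_tait (white D) (crossings D - T) w B"
  shows "opposite ` (A \<union> B) \<in> perfect_discrete_morse_functions D"
proof -
  obtain depth_b :: "'d set \<Rightarrow> nat" and M\<^sub>b where M\<^sub>b: "M\<^sub>b \<subseteq> darts D" "A = opposite ` M\<^sub>b"
      "crossing D ` M\<^sub>b = T" "inj_on (crossing D) M\<^sub>b"
      "region D ` M\<^sub>b = black D - {b}" "inj_on (region D) M\<^sub>b"
    and depth_b: "\<And>d. d \<in> M\<^sub>b \<Longrightarrow> depth_b (region D (opposite d)) < depth_b (region D d)"
    by (rule rooted_taitE[OF colour_black A], rule that)
  obtain depth_w :: "'d set \<Rightarrow> nat" and M\<^sub>w where M\<^sub>w: "M\<^sub>w \<subseteq> darts D" "B = opposite ` M\<^sub>w"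
      "crossing D ` M\<^sub>w = crossings D - T" "inj_on (crossing D) M\<^sub>w"
      "region D ` M\<^sub>w = white D - {w}" "inj_on (region D) M\<^sub>w"
    and depth_w: "\<And>d. d \<in> M\<^sub>w \<Longrightarrow> depth_w (region D (opposite d)) < depth_w (region D d)"
    by (rule rooted_taitE[OF colour_white B], rule that)
  define M where "M = M\<^sub>b \<union> M\<^sub>w"
  have M: "M \<subseteq> darts D" using M\<^sub>b(1) M\<^sub>w(1) by (simp add: M_def)
  have roots: "b \<in> black D" "w \<in> white D"
    using A B by (simp_all add: spanning_arborescence_def)
  have "region D d \<in> black D" if "d \<in> M\<^sub>b" for d
    using imageI[OF that, of "region D"] M\<^sub>b(5) by simp
  moreover have "region D d \<in> white D" if "d \<in> M\<^sub>w" for d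
    using imageI[OF that, of "region D"] M\<^sub>w(5) by simp
  ultimately have black_M: "region D d \<in> black D \<longleftrightarrow> d \<in> M\<^sub>b" if "d \<in> M" for d
    using that regions_split(2) unfolding M_def by blast
  have crossing_M: "crossing D ` M = crossings D"
    unfolding M_def image_Un M\<^sub>b(3) M\<^sub>w(3) using T by blast
  have region_M: "region D ` M = regions D - {b, w}"
    unfolding M_def image_Un M\<^sub>b(5) M\<^sub>w(5) using regions_split roots by auto
  have inj_crossing: "inj_on (crossing D) M"
    unfolding M_def using M\<^sub>b(4) M\<^sub>w(4)
    by (rule inj_on_Un_disjoint_images) (simp add: M\<^sub>b(3) M\<^sub>w(3))
  have inj_region: "inj_on (region D) M"
    unfolding M_def using M\<^sub>b(6) M\<^sub>w(6)
    by (rule inj_on_Un_disjoint_images) (use regions_split(2) in \<open>auto simp: M\<^sub>b(5) M\<^sub>w(5)\<close>)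
  have opposite_M: "opposite ` (A \<union> B) = M"
    using M opposite_opposite unfolding M\<^sub>b(2) M\<^sub>w(2) M_def
    by (simp add: image_Un image_image subset_iff cong: image_cong_simp)

  \<comment> \<open>The region with which a crossing is matched, i.e. the child end of its tree
    edge.\<close>
  define child where "child c = region D (the_inv_into M (crossing D) c)" for c
  have child: "child (crossing D d) = region D d" if "d \<in> M" for d
    using that inj_crossing by (simp add: child_def the_inv_into_f_f)
  define K where "K = (\<Sum>v\<in>regions D. depth_b v + depth_w v)"
  have K: "depth_b v + depth_w v \<le> K" if "v \<in> regions D" for v
    unfolding K_def using that finite_regions by (intro member_le_sum) auto
  \<comment> \<open>Doubling leaves odd values for crossings, placed between the values of child and
    parent. Black values rise with depth and stay at most \<open>2 * K\<close>; white values fall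
    with depth, as decreasing paths there run away from the root, and stay above
    \<open>2 * K\<close>. A child has positive depth, so subtracting 1 is exact.\<close>
  define \<phi> where "\<phi> x = (case x of
      Region v \<Rightarrow> if v \<in> black D then 2 * depth_b v else 2 + 4 * K - 2 * depth_w v
    | Crossing c \<Rightarrow> if c \<in> T then 2 * depth_b (child c) - 1 else 3 + 4 * K - 2 * depth_w (child c))" for x
  have "if region D d \<in> black D \<longleftrightarrow> d \<in> M
      then \<phi> (Crossing (crossing D d)) < \<phi> (Region (region D d))
      else \<phi> (Region (region D d)) < \<phi> (Crossing (crossing D d))" if d: "d \<in> darts D" for d
  proof -
    obtain m where m: "m \<in> M" "crossing D m = crossing D d"
      using crossing_M d crossing_in_crossings by (metis imageE)
    have m_dart: "m \<in> darts D" using m M by blast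
    have child_d: "child (crossing D d) = region D m" using child[OF m(1)] m(2) by simp
    have T_iff: "crossing D d \<in> T \<longleftrightarrow> m \<in> M\<^sub>b"
      using m M\<^sub>b(3) M\<^sub>w(3) unfolding M_def by blast
    have other: "d = m \<or> d = opposite m" if "region D d \<in> black D \<longleftrightarrow> m \<in> M\<^sub>b"
    proof (cases "m \<in> M\<^sub>b")
      case True
      then show ?thesis
        using that same_crossing_same_colour[OF colour_black d m_dart] m black_M by simp
    next
      case False
      then show ?thesis
        using that same_crossing_same_colour[OF colour_white d m_dart] m black_M[OF m(1)]
          region_white_iff[OF d] region_white_iff[OF m_dart] by simp
    qed
    have opposite_notin: "opposite m \<notin> M"
      using inj_onD[OF inj_crossing, of "opposite m" m] m(1) opposite_neq[OF m_dart] by auto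
    note bounds = K[OF region_in_regions[OF d]] K[OF region_in_regions[OF m_dart]]
    have "m \<in> M\<^sub>b \<Longrightarrow> depth_b (region D (opposite m)) < depth_b (region D m)"
      "m \<notin> M\<^sub>b \<Longrightarrow> depth_w (region D (opposite m)) < depth_w (region D m)"
      using depth_b depth_w m(1) by (auto simp: M_def)
    note depths = this
    \<comment> \<open>In the third and fourth cases crossing and region belong to different colours
      and the gap at \<open>2 * K\<close> decides; otherwise the crossing is compared with its child
      or its parent.\<close>
    consider "m \<in> M\<^sub>b" "region D d \<in> black D" "d = m" | "m \<in> M\<^sub>b" "region D d \<in> black D" "d = opposite m"
      | "m \<in> M\<^sub>b" "region D d \<notin> black D" | "m \<notin> M\<^sub>b" "region D d \<in> black D"
      | "m \<notin> M\<^sub>b" "region D d \<notin> black D" "d = m" | "m \<notin> M\<^sub>b" "region D d \<notin> black D" "d = opposite m"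
      using other by blast
    then show ?thesis
    proof cases
      case 1
      then show ?thesis using m depths T_iff child_d by (simp add: \<phi>_def)
    next
      case 2
      then show ?thesis using opposite_notin depths(1) T_iff child_d by (simp add: \<phi>_def)
    next
      case 3
      then have "d \<noteq> m" using black_M[OF m(1)] by auto
      then have "d \<notin> M" using inj_onD[OF inj_crossing, of d m] m by auto
      then show ?thesis using 3 bounds T_iff child_d by (simp add: \<phi>_def)
    next
      case 4
      then have "d \<noteq> m" using black_M[OF m(1)] by auto
      then have "d \<notin> M" using inj_onD[OF inj_crossing, of d m] m by auto
      then show ?thesis using 4 bounds T_iff child_d by (simp add: \<phi>_def)
    next
      case 5
      then show ?thesis using m bounds T_iff child_d by (simp add: \<phi>_def)
    next
      case 6
      then show ?thesis using opposite_notin bounds depths(2) T_iff child_d by (simp add: \<phi>_def)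
    qed
  qed
  then have "acyclic_matching (poset_graph D) M"
    unfolding acyclic_matching_def poset_matching_iff poset_acyclic_iff_potential
    using M inj_region inj_crossing by blast
  moreover have "unmatched (poset_graph D) M = {Region b, Region w}"
    unfolding poset_unmatched crossing_M region_M using roots regions_split by auto
  ultimately show ?thesis
    unfolding opposite_M perfect_discrete_morse_functions_def discrete_morse_functions_def
    using roots by blast
qed

text \<open>Sorting the matched corners by colour gives two sets of parent pointers, and the
  acyclicity potential supplies their depths.\<close>

lemma perfect_rooted_taits:
  assumes "M \<in> perfect_discrete_morse_functions D"
  obtains b w T A B where "b \<in> black D" "w \<in> white D" "T \<subseteq> crossings D"
    "rooted_tait (black D) T b A" "rooted_tait (white D) (crossings D - T) w B"
    "M = opposite ` (A \<union> B)"
proof -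
  obtain b w where roots: "b \<in> black D" "w \<in> white D"
    and acyclic: "acyclic_matching (poset_graph D) M"
    and unmatched: "unmatched (poset_graph D) M = {Region b, Region w}"
    using assms unfolding perfect_discrete_morse_functions_def discrete_morse_functions_def by blast
  have M: "M \<subseteq> darts D" and inj_region: "inj_on (region D) M" and inj_crossing: "inj_on (crossing D) M"
    using acyclic by (auto simp: acyclic_matching_def poset_matching_iff)
  have "\<exists>\<phi> :: 'd cell \<Rightarrow> nat. \<forall>d\<in>darts D.
        if region D d \<in> black D \<longleftrightarrow> d \<in> M
        then \<phi> (Crossing (crossing D d)) < \<phi> (Region (region D d))
        else \<phi> (Region (region D d)) < \<phi> (Crossing (crossing D d))"
    using acyclic unfolding acyclic_matching_def poset_acyclic_iff_potential by blast
  then obtain \<phi> :: "'d cell \<Rightarrow> nat" where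
    \<phi>: "\<And>d. d \<in> darts D \<Longrightarrow>
        if region D d \<in> black D \<longleftrightarrow> d \<in> M
        then \<phi> (Crossing (crossing D d)) < \<phi> (Region (region D d))
        else \<phi> (Region (region D d)) < \<phi> (Crossing (crossing D d))" by blast
  have "Region ` (regions D - region D ` M) \<union> Crossing ` (crossings D - crossing D ` M) = {Region b, Region w}"
    using unmatched by (simp only: poset_unmatched)
  then have rest: "regions D - region D ` M = {b, w}" "crossings D - crossing D ` M = {}"
    by blast+
  have sub: "region D ` M \<subseteq> regions D" "crossing D ` M \<subseteq> crossings D"
    using M by (auto intro: region_in_regions crossing_in_crossings)
  have region_M: "region D ` M = regions D - {b, w}"
    using double_diff[OF sub(1) subset_refl] unfolding rest(1) by (rule sym)
  have crossing_M: "crossing D ` M = crossings D"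
    using sub(2) rest(2) by (simp add: subset_antisym)
  define M\<^sub>b where "M\<^sub>b = {d \<in> M. region D d \<in> black D}"
  define M\<^sub>w where "M\<^sub>w = {d \<in> M. region D d \<in> white D}"
  have M_split: "M = M\<^sub>b \<union> M\<^sub>w"
    using M region_white_iff by (auto simp: M\<^sub>b_def M\<^sub>w_def)
  have disjoint: "M\<^sub>b \<inter> M\<^sub>w = {}"
    using regions_split(2) by (auto simp: M\<^sub>b_def M\<^sub>w_def)
  have opposite_notin: "opposite d \<notin> M" if "d \<in> M" for d
    using inj_onD[OF inj_crossing, of "opposite d" d] that M opposite_neq[of d] by auto
  \<comment> \<open>In the reversed graph \<open>d\<close> leads from its region to the crossing,
    and the unmatched corner \<open>opposite d\<close> leads on to the parent.\<close>
  have descend_b: "\<phi> (Region (region D (opposite d))) < \<phi> (Region (region D d))" if "d \<in> M\<^sub>b" for d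
  proof -
    have d: "d \<in> M" "d \<in> darts D" "region D d \<in> black D" using that M by (auto simp: M\<^sub>b_def)
    then show ?thesis
      using \<phi>[of d] \<phi>[of "opposite d"] opposite_notin[of d]
        region_opposite_colour[OF colour_black, of d] by simp
  qed
  \<comment> \<open>For white corners the path runs from the parent through the crossing to the
    child.\<close>
  have descend_w: "\<phi> (Region (region D d)) < \<phi> (Region (region D (opposite d)))" if "d \<in> M\<^sub>w" for d
  proof -
    have d: "d \<in> M" "d \<in> darts D" "region D d \<notin> black D"
      using that M by (auto simp: M\<^sub>w_def white_def)
    then show ?thesis
      using \<phi>[of d] \<phi>[of "opposite d"] opposite_notin[of d]
        region_opposite_colour[OF colour_black, of d] by simp
  qed
  \<comment> \<open>White potentials fall away from the root; subtracting them from a bound turns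
    them into depths.\<close>
  define K where "K = (\<Sum>v\<in>regions D. \<phi> (Region v))"
  have K: "\<phi> (Region v) \<le> K" if "v \<in> regions D" for v
    unfolding K_def using that finite_regions by (intro member_le_sum) auto
  have regions_b: "(regions D - {b, w}) \<inter> black D = black D - {b}"
    and regions_w: "(regions D - {b, w}) \<inter> white D = white D - {w}"
    using roots regions_split by blast+
  have tree_b: "rooted_tait (black D) (crossing D ` M\<^sub>b) b (opposite ` M\<^sub>b)"
  proof (rule rooted_tait_opposite[OF colour_black roots(1), where depth = "\<lambda>v. \<phi> (Region v)"])
    have "region D ` M\<^sub>b = region D ` M \<inter> black D" by (auto simp: M\<^sub>b_def)
    then show "region D ` M\<^sub>b = black D - {b}"
      by (simp only: region_M regions_b)
    show "inj_on (region D) M\<^sub>b" using inj_region M_split by (simp add: inj_on_Un)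
  qed (use M M_split descend_b in auto)
  have tree_w: "rooted_tait (white D) (crossing D ` M\<^sub>w) w (opposite ` M\<^sub>w)"
  proof (rule rooted_tait_opposite[OF colour_white roots(2), where depth = "\<lambda>v. K - \<phi> (Region v)"])
    have "region D ` M\<^sub>w = region D ` M \<inter> white D" by (auto simp: M\<^sub>w_def)
    then show "region D ` M\<^sub>w = white D - {w}"
      by (simp only: region_M regions_w)
    show "inj_on (region D) M\<^sub>w" using inj_region M_split by (simp add: inj_on_Un)
    show "K - \<phi> (Region (region D (opposite d))) < K - \<phi> (Region (region D d))" if "d \<in> M\<^sub>w" for d
    proof -
      have "opposite d \<in> darts D" using that M M_split by auto
      then show ?thesis
        using descend_w[OF that] K[OF region_in_regions, of "opposite d"] by linarith
    qed
  qed (use M M_split in auto)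
  \<comment> \<open>Every crossing is matched exactly once, so the two colours divide the crossings
    between them.\<close>
  have "crossing D ` M\<^sub>w = crossings D - crossing D ` M\<^sub>b"
  proof -
    have "M\<^sub>w = M - M\<^sub>b" using M_split disjoint by blast
    moreover have "crossing D ` (M - M\<^sub>b) = crossing D ` M - crossing D ` M\<^sub>b"
      using inj_crossing by (rule inj_on_image_set_diff) (use M_split in auto)
    ultimately show ?thesis by (simp add: crossing_M)
  qed
  moreover have "crossing D ` M\<^sub>b \<subseteq> crossings D"
    using crossing_M M_split by blast
  moreover have "M = opposite ` (opposite ` M\<^sub>b \<union> opposite ` M\<^sub>w)"
    using M opposite_opposite M_split
    by (simp add: image_Un image_image subset_iff cong: image_cong_simp)
  ultimately show thesis
    using that[OF roots _ tree_b _ ] tree_w by simp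
qed

section \<open>Agreement of the two sets of matchings\<close>

lemma kpw_eq:
  assumes T: "T \<subseteq> crossings D"
    and A: "rooted_tait (black D) T b A"
    and B: "rooted_tait (white D) (crossings D - T) w B"
  shows "kpw D b w T = opposite ` (A \<union> B)"
  unfolding kpw_def rooted_tait_away_from[OF colour_black A T]
    rooted_tait_away_from[OF colour_white B Diff_subset] ..

text \<open>From left to right the white tree has to be produced by duality; from right to left both
  trees are read off the matching.\<close>

lemma kpw_images_eq_perfect:
  "(\<Union>b\<in>black D. \<Union>w\<in>white D. kpw D b w ` spanning_trees D (black D)) =
    perfect_discrete_morse_functions D"
proof (intro set_eqI iffI)
  fix M assume "M \<in> (\<Union>b\<in>black D. \<Union>w\<in>white D. kpw D b w ` spanning_trees D (black D))"
  then obtain b w T where bw: "b \<in> black D" "w \<in> white D"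
    and tree: "T \<in> spanning_trees D (black D)" and M: "M = kpw D b w T" by blast
  have T: "T \<subseteq> crossings D" using tree unfolding spanning_trees_def by blast
  obtain A where A: "rooted_tait (black D) T b A"
    using colour_black tree bw(1) by (rule spanning_tree_rooted_tait)
  obtain B where B: "rooted_tait (white D) (crossings D - T) w B"
    using A T bw(2) by (rule dual_rooted_tait)
  show "M \<in> perfect_discrete_morse_functions D"
    unfolding M kpw_eq[OF T A B] using T A B by (rule rooted_taits_perfect)
next
  fix M assume "M \<in> perfect_discrete_morse_functions D"
  then obtain b w T A B where bw: "b \<in> black D" "w \<in> white D" and T: "T \<subseteq> crossings D"
    and A: "rooted_tait (black D) T b A" and B: "rooted_tait (white D) (crossings D - T) w B"
    and M: "M = opposite ` (A \<union> B)"
    by (rule perfect_rooted_taits)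
  have "M = kpw D b w T" unfolding M using kpw_eq[OF T A B] by simp
  moreover have "T \<in> spanning_trees D (black D)"
    using colour_black A T by (rule rooted_tait_spanning_tree)
  ultimately show "M \<in> (\<Union>b\<in>black D. \<Union>w\<in>white D. kpw D b w ` spanning_trees D (black D))"
    using bw by blast
qed

end

theorem corollary6p4:
  fixes D :: "'d knot_projection"
  assumes "knot_diagram D" and "reduced D"
  shows "\<exists>f. bij_betw f
           (\<Union>v\<^sub>b\<in>black D. \<Union>v\<^sub>w\<in>white D. kpw D v\<^sub>b v\<^sub>w ` spanning_trees D (black D))
           (perfect_discrete_morse_functions D)"
proof -
  interpret reduced_knot_diagram D
    using assms by unfold_locales
  show ?thesis
    unfolding kpw_images_eq_perfect using bij_betw_id by blast
qed

end
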